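(* The following quantum algorithm solves the $d$-level Bernstein-Vazirani problem, i.e. it finds the unknown string $s\in\{0,1,\dots,d-1\}^n$, using a single query to the oracle for $f_s(x)=s\cdot x \bmod d$. (1) Apply $\mathcal{F}^{\otimes n}$ to $|00\dots0\rangle$, which gives $|\Psi\rangle=\frac{1}{\sqrt{d^n}}\sum_{x}|x\rangle$. (2) Feed $|\Psi\rangle$ to the oracle as the query, and use the oracle's output $f_s(x)$ as the control of a SUM gate whose target qudit is in the state $|\phi\rangle=\omega^{d}|0\rangle+\omega^{d-1}|1\rangle+\dots+\omega|d-1\rangle$. For control value $i=f_s(x)$ the SUM gate sends $|\phi\rangle$ to $\omega^{i}|\phi\rangle=\omega^{s\cdot x}|\phi\rangle$. Hence, associating the phase with the first $n$ qudits, their state becomes $$|\psi_s\rangle=\frac{1}{\sqrt{d^n}}\sum_{x}\omega^{s\cdot x}|x\rangle .$$ (3) Apply $\mathcal{F}^{\otimes n}$ again to the first $n$ qudits. Then $$\mathcal{F}^{\otimes n}|\psi_s\rangle=|s\rangle ,$$ so measuring the first $n$ qudits yields $s$. Only one input is given to the oracle, so the quantum query complexity is the same as in the case $d=2$, namely $\Omega(1)$.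
   Context: A qudit is a quantum system with state space $\mathbb{C}^d$ and orthonormal computational basis $|0\rangle,\dots,|d-1\rangle$; $\omega$ is a primitive $d$-th root of unity. For $x=(x_1,\dots,x_n)\in\{0,\dots,d-1\}^n$, $|x\rangle=|x_1\rangle\otimes\cdots\otimes|x_n\rangle$, and $s\cdot x=\sum_{i=1}^n s_ix_i$. All sums over $x$ and $y$ run over $\{0,1,\dots,d-1\}^n$. The $d$-level Bernstein-Vazirani problem: an unknown string $s\in\{0,\dots,d-1\}^n$ is to be found by querying the function $f_s(x)=s\cdot x\bmod d$, given as a quantum oracle. The $n$-fold tensor product of the $d$-dimensional discrete Fourier transform is $$\mathcal{F}^{\otimes n}=\frac{1}{\sqrt{d^n}}\sum_{x,y}\omega^{x\cdot y}|y\rangle\langle x| .$$ The SUM gate is $|i\rangle|j\rangle\mapsto|i\rangle|(i+j)\bmod d\rangle$, with $i$ the control value and $j$ the target value. The target state $|\phi\rangle$ is written without a normalization factor. Measurement is in the computational basis.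
   Formalization: Step (3) as printed fails (d=3, n=1, s=1 gives |2⟩): applying F^{⊗n} again yields |−s mod d⟩, equal to |s⟩ iff 2s≡0 mod d componentwise. The theorem uses the inverse transform to get |s⟩ and also states what the printed circuit gives. It assumes d≥2 and n≥1. *)

theory Defs
  imports Complex_Main "HOL-Library.Landau_Symbols"
begin

(* A register with finite computational basis B is described by its amplitude function
   on basis labels.  An operator A is given by its matrix entries, A y x = <y|A|x>. *)
type_synonym 'b state = "'b \<Rightarrow> complex"
type_synonym 'b oper = "'b \<Rightarrow> 'b \<Rightarrow> complex"

definition ket :: "'b \<Rightarrow> 'b state" where
  "ket x = (\<lambda>z. if z = x then 1 else 0)"

definition scale :: "complex \<Rightarrow> 'b state \<Rightarrow> 'b state" where
  "scale c \<psi> = (\<lambda>z. c * \<psi> z)"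

definition superpos :: "'a set \<Rightarrow> ('a \<Rightarrow> 'b state) \<Rightarrow> 'b state" where
  "superpos X \<psi> = (\<lambda>z. \<Sum>x\<in>X. \<psi> x z)"

definition tensor :: "'a state \<Rightarrow> 'b state \<Rightarrow> ('a \<times> 'b) state" where
  "tensor \<psi> \<phi> = (\<lambda>(x, j). \<psi> x * \<phi> j)"

definition apply_op :: "'b set \<Rightarrow> 'b oper \<Rightarrow> 'b state \<Rightarrow> 'b state" where
  "apply_op B A \<psi> = (\<lambda>y. \<Sum>x\<in>B. A y x * \<psi> x)"

definition adjoint_op :: "'b oper \<Rightarrow> 'b oper" where
  "adjoint_op A = (\<lambda>y x. cnj (A x y))"

definition unitary_on :: "'b set \<Rightarrow> 'b oper \<Rightarrow> bool" where
  "unitary_on B A \<longleftrightarrow>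
     (\<forall>x\<in>B. \<forall>y\<in>B. (\<Sum>z\<in>B. cnj (A z x) * A z y) = (if x = y then 1 else 0))"

(* A tensored with the identity on the second register *)
definition on_fst :: "'a oper \<Rightarrow> ('a \<times> 'b) oper" where
  "on_fst A = (\<lambda>(y, k) (x, j). if k = j then A y x else 0)"

(* Born rule for the first register; the division makes it independent of the
   normalization of the state. *)
definition prob_fst :: "'a set \<Rightarrow> 'b set \<Rightarrow> ('a \<times> 'b) state \<Rightarrow> 'a \<Rightarrow> real" where
  "prob_fst X Y \<Phi> x =
     (\<Sum>j\<in>Y. (cmod (\<Phi> (x, j)))\<^sup>2) / (\<Sum>b\<in>X \<times> Y. (cmod (\<Phi> b))\<^sup>2)"


definition primitive_root_of_unity :: "nat \<Rightarrow> complex \<Rightarrow> bool" where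
  "primitive_root_of_unity d \<omega> \<longleftrightarrow> \<omega> ^ d = 1 \<and> (\<forall>k. 0 < k \<and> k < d \<longrightarrow> \<omega> ^ k \<noteq> 1)"

definition strings :: "nat \<Rightarrow> nat \<Rightarrow> nat list set" where
  "strings d n = {x. length x = n \<and> set x \<subseteq> {..<d}}"

definition dot :: "nat list \<Rightarrow> nat list \<Rightarrow> nat" where
  "dot s x = (\<Sum>i<length s. s ! i * x ! i)"

definition bv_fun :: "nat \<Rightarrow> nat list \<Rightarrow> nat list \<Rightarrow> nat" where
  "bv_fun d s x = dot s x mod d"

definition neg_mod :: "nat \<Rightarrow> nat list \<Rightarrow> nat list" where
  "neg_mod d s = map (\<lambda>a. (d - a) mod d) s"

definition qft :: "nat \<Rightarrow> nat \<Rightarrow> complex \<Rightarrow> nat list oper" where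
  "qft d n \<omega> = (\<lambda>b a. 1 / complex_of_real (sqrt (real (d ^ n))) *
     (\<Sum>x\<in>strings d n. \<Sum>y\<in>strings d n. \<omega> ^ dot x y * (ket y b * cnj (ket x a))))"

definition sum_gate :: "nat \<Rightarrow> (nat \<times> nat) oper" where
  "sum_gate d = (\<lambda>b (i, j). ket (i, (i + j) mod d) b)"

(* One query to the oracle for f, whose output f x is the control of a SUM gate acting
   on the target qudit: |x>|j> is sent to |x>|(f x + j) mod d>.  This is also the
   standard form of a quantum oracle for f. *)
definition oracle_gate :: "nat \<Rightarrow> (nat list \<Rightarrow> nat) \<Rightarrow> (nat list \<times> nat) oper" where
  "oracle_gate d f = (\<lambda>(y, k) (x, j). if y = x then sum_gate d (f x, k) (f x, j) else 0)"

definition uniform_state :: "nat \<Rightarrow> nat \<Rightarrow> nat list state" where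
  "uniform_state d n =
     scale (1 / complex_of_real (sqrt (real (d ^ n)))) (superpos (strings d n) ket)"

definition target_state :: "nat \<Rightarrow> complex \<Rightarrow> nat state" where
  "target_state d \<omega> = superpos {..<d} (\<lambda>j. scale (\<omega> ^ (d - j)) (ket j))"

definition phase_state :: "nat \<Rightarrow> nat \<Rightarrow> complex \<Rightarrow> nat list \<Rightarrow> nat list state" where
  "phase_state d n \<omega> s =
     scale (1 / complex_of_real (sqrt (real (d ^ n))))
       (superpos (strings d n) (\<lambda>x. scale (\<omega> ^ dot s x) (ket x)))"


(* U 0, then q rounds of: oracle query Q, followed by the next U k *)
fun query_state :: "'b set \<Rightarrow> 'b oper \<Rightarrow> (nat \<Rightarrow> 'b oper) \<Rightarrow> nat \<Rightarrow> 'b state \<Rightarrow> 'b state" where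
  "query_state B Q U 0 \<psi> = apply_op B (U 0) \<psi>"
| "query_state B Q U (Suc q) \<psi> =
     apply_op B (U (Suc q)) (apply_op B Q (query_state B Q U q \<psi>))"

(* The Bernstein-Vazirani circuit with oracle f, a single query, and the operator G
   applied to the first n qudits after the query.  The Fourier transform with kernel
   \<omega>^(x.y) squares to |s> \<mapsto> |-s mod d>, so repeating it (G = qft d n \<omega>) gives |s> exactly
   for those s with 2 s = 0 mod d, in particular for every s if d = 2.  For general d it
   is the inverse transform (G = adjoint_op (qft d n \<omega>)) that gives |s>. *)
definition bv_circuit ::
  "nat \<Rightarrow> nat \<Rightarrow> complex \<Rightarrow> nat list oper \<Rightarrow> (nat list \<Rightarrow> nat) \<Rightarrow> (nat list \<times> nat) state" where
  "bv_circuit d n \<omega> G f =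
     query_state (strings d n \<times> {..<d}) (oracle_gate d f)
       (\<lambda>k. on_fst (if k = 0 then qft d n \<omega> else G)) 1
       (tensor (ket (replicate n 0)) (target_state d \<omega>))"

(* Some q-query algorithm finds every s with probability at least p.  The registers are
   n query qudits, the oracle's target qudit and an m-dimensional workspace; the final
   measurement is in the computational basis, with classical post-processing res. *)
definition bv_solvable :: "real \<Rightarrow> nat \<Rightarrow> nat \<Rightarrow> nat \<Rightarrow> bool" where
  "bv_solvable p d n q \<longleftrightarrow>
     (\<exists>m>0. \<exists>(U :: nat \<Rightarrow> ((nat list \<times> nat) \<times> nat) oper) (res :: (nat list \<times> nat) \<times> nat \<Rightarrow> nat list).
        let B = (strings d n \<times> {..<d}) \<times> {..<m} in
        (\<forall>k\<le>q. unitary_on B (U k)) \<and>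
        (\<forall>s\<in>strings d n.
           p \<le> (\<Sum>b\<in>{b \<in> B. res b = s}.
                  (cmod (query_state B (on_fst (oracle_gate d (bv_fun d s))) U q
                           (ket ((replicate n 0, 0), 0)) b))\<^sup>2)))"

definition bv_query_complexity :: "real \<Rightarrow> nat \<Rightarrow> nat \<Rightarrow> nat" where
  "bv_query_complexity p d n = (LEAST q. bv_solvable p d n q)"

end

(* The target state is an eigenvector of every shift j -> (i + j) mod d with eigenvalue \<omega>^i, so
   the query only multiplies |x> by \<omega>^(s.x).  The characters x -> \<omega>^(s.x) are orthogonal, because
   their sums over strings factor into geometric sums, so the inverse Fourier transform maps the
   phase state to |s>.  With no query the final state is the same for all s, hence two different
   strings cannot both be found with probability above 1/2. *)
theory Submission
  imports Defs
begin

section \<open>Strings over an alphabet of \<open>d\<close> digits and sums over them\<close>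

lemma strings_0 [simp]: "strings d 0 = {[]}"
  by (auto simp: strings_def)

lemma strings_Suc: "strings d (Suc n) = (\<lambda>(a, x). a # x) ` ({..<d} \<times> strings d n)"
  by (auto simp: strings_def length_Suc_conv image_iff)

lemma finite_strings [simp]: "finite (strings d n)"
proof (induction n)
  case (Suc n)
  then show ?case unfolding strings_Suc by (intro finite_imageI finite_cartesian_product) auto
qed simp

lemma strings_nth_less: "x \<in> strings d n \<Longrightarrow> i < n \<Longrightarrow> x ! i < d"
  unfolding strings_def using nth_mem by fastforce

lemma strings_length: "x \<in> strings d n \<Longrightarrow> length x = n"
  by (simp add: strings_def)

lemma replicate_in_strings: "a < d \<Longrightarrow> replicate n a \<in> strings d n"
  by (auto simp: strings_def)

text \<open>Distributivity, by splitting off the first digit. The family \<open>f\<close> is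
  generalized in the induction because the tail sees it shifted by one index.\<close>

lemma sum_strings_prod:
  fixes f :: "nat \<Rightarrow> nat \<Rightarrow> 'a::comm_semiring_1"
  shows "(\<Sum>x\<in>strings d n. \<Prod>i<n. f i (x ! i)) = (\<Prod>i<n. \<Sum>a<d. f i a)"
proof (induction n arbitrary: f)
  case (Suc n)
  have "(\<Sum>x\<in>strings d (Suc n). \<Prod>i<Suc n. f i (x ! i))
      = (\<Sum>(a, x)\<in>{..<d} \<times> strings d n. f 0 a * (\<Prod>i<n. f (Suc i) (x ! i)))"
    unfolding strings_Suc
    by (subst sum.reindex) (auto simp: inj_on_def prod.lessThan_Suc_shift simp del: prod.lessThan_Suc intro!: sum.cong)
  also have "\<dots> = (\<Sum>a<d. f 0 a) * (\<Sum>x\<in>strings d n. \<Prod>i<n. f (Suc i) (x ! i))"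
    by (simp add: sum_product sum.cartesian_product)
  also have "\<dots> = (\<Prod>i<Suc n. \<Sum>a<d. f i a)"
    by (simp only: Suc.IH[of "\<lambda>i. f (Suc i)"] prod.lessThan_Suc_shift)
  finally show ?case .
qed simp

lemma geometric_sum_root_of_unity:
  fixes z :: complex
  assumes "z ^ d = 1"
  shows "(\<Sum>a<d. z ^ a) = (if z = 1 then of_nat d else 0)"
  using assms by (simp add: sum_gp_strict)

text \<open>A character of the group of strings is a product of one-digit characters, so its sum is
  a product of geometric sums; a single ratio other than 1 makes it vanish.\<close>

lemma sum_strings_characters:
  fixes z :: "nat \<Rightarrow> complex"
  assumes "\<And>i. i < n \<Longrightarrow> z i ^ d = 1"
  shows "(\<Sum>x\<in>strings d n. \<Prod>i<n. z i ^ (x ! i))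
    = (if \<forall>i<n. z i = 1 then of_nat (d ^ n) else 0)"
proof -
  have "(\<Sum>x\<in>strings d n. \<Prod>i<n. z i ^ (x ! i)) = (\<Prod>i<n. if z i = 1 then of_nat d else 0)"
    unfolding sum_strings_prod[of "\<lambda>i a. z i ^ a"]
    using assms by (intro prod.cong refl geometric_sum_root_of_unity) auto
  also have "\<dots> = (if \<forall>i<n. z i = 1 then of_nat (d ^ n) else 0)"
    by (cases "\<forall>i<n. z i = 1") auto
  finally show ?thesis .
qed

section \<open>The dot product as an exponent, and digitwise negation modulo
  \<open>d\<close>\<close>

lemma power_dot:
  fixes w :: complex
  shows "length s = n \<Longrightarrow> w ^ dot s x = (\<Prod>i<n. (w ^ (s ! i)) ^ (x ! i))"
  by (simp add: dot_def power_sum power_mult)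

lemma dot_commute: "length s = length x \<Longrightarrow> dot s x = dot x s"
  by (simp add: dot_def mult.commute)

lemma neg_mod_in_strings: "d > 0 \<Longrightarrow> s \<in> strings d n \<Longrightarrow> neg_mod d s \<in> strings d n"
  by (auto simp: strings_def neg_mod_def)

text \<open>The reduction of \<open>d - a\<close> only matters for \<open>a = 0\<close>. Otherwise
  the sum of two digits is divisible by \<open>d\<close> exactly when it equals
  \<open>d\<close>.\<close>

lemma neg_mod_component:
  fixes a b d :: nat
  assumes "a < d" "b < d"
  shows "b = (d - a) mod d \<longleftrightarrow> (a + b) mod d = 0"
proof (cases "a = 0")
  case False
  then have "(a + b) mod d = (if a + b < d then a + b else a + b - d)"
    using assms by (auto simp: mod_if)
  then show ?thesis using assms False by auto
qed (use assms in auto)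

text \<open>Puts negation into the digitwise form in which the character sums test it.\<close>

lemma eq_neg_mod_iff:
  assumes "s \<in> strings d n" "y \<in> strings d n"
  shows "y = neg_mod d s \<longleftrightarrow> (\<forall>i<n. (s ! i + y ! i) mod d = 0)"
  using assms
  by (auto simp: list_eq_iff_nth_eq strings_length neg_mod_def strings_nth_less neg_mod_component)

text \<open>The congruences of \<open>eq_neg_mod_iff\<close> are symmetric in the two
  strings.\<close>

lemma neg_mod_neg_mod:
  assumes "d > 0" "s \<in> strings d n"
  shows "neg_mod d (neg_mod d s) = s"
  using eq_neg_mod_iff[OF assms(2) neg_mod_in_strings[OF assms]]
    eq_neg_mod_iff[OF neg_mod_in_strings[OF assms] assms(2)]
  by (simp add: add.commute)

section \<open>Kets, tensor products and unitarity\<close>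

lemma ket_eq_iff: "ket a = ket b \<longleftrightarrow> a = b"
proof
  assume "ket a = ket b"
  then have "ket a a = ket b a" by simp
  then show "a = b" by (auto simp: ket_def split: if_splits)
qed simp

lemma tensor_ket: "tensor (ket a) (ket b) = ket (a, b)"
  by (auto simp: tensor_def ket_def fun_eq_iff)

lemma tensor_scale_right: "tensor \<psi> (scale c \<phi>) = scale c (tensor \<psi> \<phi>)"
  by (auto simp: tensor_def scale_def fun_eq_iff)

lemma apply_op_scale: "apply_op B A (scale c \<psi>) = scale c (apply_op B A \<psi>)"
  by (auto simp: apply_op_def scale_def sum_distrib_left fun_eq_iff intro!: sum.cong)

lemma apply_op_ket: "finite B \<Longrightarrow> b \<in> B \<Longrightarrow> apply_op B A (ket b) = (\<lambda>y. A y b)"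
  by (auto simp: apply_op_def ket_def fun_eq_iff if_distrib sum.delta cong: if_cong)

definition tensor_op :: "'a oper \<Rightarrow> 'b oper \<Rightarrow> ('a \<times> 'b) oper" where
  "tensor_op A C = (\<lambda>(y, k) (x, j). A y x * C k j)"

definition id_op :: "'b oper" where
  "id_op = (\<lambda>k j. if k = j then 1 else 0)"

text \<open>Makes \<open>on_fst\<close> a special case of the tensor product, so that its action on
  product states and its unitarity follow from the general facts.\<close>

lemma on_fst_eq_tensor_op: "on_fst A = tensor_op A id_op"
  by (auto simp: on_fst_def tensor_op_def id_op_def fun_eq_iff)

lemma apply_tensor_op:
  "apply_op (X \<times> Y) (tensor_op A C) (tensor \<psi> \<phi>) = tensor (apply_op X A \<psi>) (apply_op Y C \<phi>)"
  by (auto simp: apply_op_def tensor_op_def tensor_def fun_eq_iff sum_product sum.cartesian_product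
      intro!: sum.cong)

text \<open>States are functions on a whole type, while \<open>apply_op\<close> sums over
  \<open>Y\<close> only; amplitudes outside \<open>Y\<close> would be lost.\<close>

lemma apply_id_op:
  assumes "finite Y" "\<And>j. j \<notin> Y \<Longrightarrow> \<phi> j = 0"
  shows "apply_op Y id_op \<phi> = \<phi>"
  using assms by (auto simp: apply_op_def id_op_def fun_eq_iff if_distrib[of "\<lambda>x. x * _"] cong: if_cong)

lemma apply_on_fst_tensor:
  assumes "finite Y" "\<And>j. j \<notin> Y \<Longrightarrow> \<phi> j = 0"
  shows "apply_op (X \<times> Y) (on_fst A) (tensor \<psi> \<phi>) = tensor (apply_op X A \<psi>) \<phi>"
  using assms by (simp add: on_fst_eq_tensor_op apply_tensor_op apply_id_op)

text \<open>The inner product of two columns factors into the inner products of the columns of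
  \<open>A\<close> and of \<open>C\<close>.\<close>

lemma unitary_on_tensor_op:
  assumes "unitary_on X A" "unitary_on Y C"
  shows "unitary_on (X \<times> Y) (tensor_op A C)"
  unfolding unitary_on_def
proof (intro ballI)
  fix u v assume uv: "u \<in> X \<times> Y" "v \<in> X \<times> Y"
  obtain x j x' j' where [simp]: "u = (x, j)" "v = (x', j')" by (cases u, cases v)
  have "(\<Sum>z\<in>X \<times> Y. cnj (tensor_op A C z u) * tensor_op A C z v)
      = (\<Sum>y\<in>X. cnj (A y x) * A y x') * (\<Sum>k\<in>Y. cnj (C k j) * C k j')"
    by (auto simp: tensor_op_def sum_product sum.cartesian_product intro!: sum.cong)
  also have "\<dots> = (if u = v then 1 else 0)"
    using assms uv by (auto simp: unitary_on_def)
  finally show "(\<Sum>z\<in>X \<times> Y. cnj (tensor_op A C z u) * tensor_op A C z v)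
      = (if u = v then 1 else 0)" .
qed

lemma unitary_on_id_op: "finite Y \<Longrightarrow> unitary_on Y id_op"
  by (auto simp: unitary_on_def id_op_def if_distrib[of cnj] if_distrib[of "\<lambda>u. u * _"] cong: if_cong)

lemma unitary_on_on_fst: "finite Y \<Longrightarrow> unitary_on X A \<Longrightarrow> unitary_on (X \<times> Y) (on_fst A)"
  by (simp add: on_fst_eq_tensor_op unitary_on_tensor_op unitary_on_id_op)

lemma unitary_on_column_norm:
  assumes "unitary_on B A" "b \<in> B"
  shows "(\<Sum>z\<in>B. (cmod (A z b))\<^sup>2) = 1"
proof -
  have "complex_of_real (\<Sum>z\<in>B. (cmod (A z b))\<^sup>2) = (\<Sum>z\<in>B. cnj (A z b) * A z b)"
    by (simp add: complex_norm_square mult.commute del: of_real_power)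
  also have "\<dots> = 1"
    using assms by (simp add: unitary_on_def)
  finally show ?thesis by (simp only: of_real_eq_1_iff)
qed

section \<open>Explicit entries of the Fourier transform and amplitudes of the states\<close>

text \<open>The two kets act as Kronecker deltas and leave one term of the double sum, or none if a
  label is not a string.\<close>

lemma qft_eq:
  "qft d n \<omega> b a = (if a \<in> strings d n \<and> b \<in> strings d n
     then \<omega> ^ dot a b / complex_of_real (sqrt (real (d ^ n))) else 0)"
proof -
  have "(\<Sum>x\<in>strings d n. \<Sum>y\<in>strings d n. \<omega> ^ dot x y * (ket y b * cnj (ket x a)))
      = (\<Sum>x\<in>strings d n. if x = a then \<Sum>y\<in>strings d n. if y = b then \<omega> ^ dot x y else 0 else 0)"
    by (rule sum.cong) (simp_all add: ket_def eq_commute if_distrib[of "\<lambda>u. _ * u"] cong: if_cong)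
  also have "\<dots> = (if a \<in> strings d n \<and> b \<in> strings d n then \<omega> ^ dot a b else 0)"
    by simp
  finally show ?thesis by (simp add: qft_def)
qed

lemma uniform_state_eq:
  "uniform_state d n x =
     (if x \<in> strings d n then 1 / complex_of_real (sqrt (real (d ^ n))) else 0)"
  by (simp add: uniform_state_def scale_def superpos_def ket_def)

lemma phase_state_eq:
  "phase_state d n \<omega> s x =
     (if x \<in> strings d n then \<omega> ^ dot s x / complex_of_real (sqrt (real (d ^ n))) else 0)"
  by (simp add: phase_state_def scale_def superpos_def ket_def if_distrib cong: if_cong)

lemma target_state_eq: "target_state d \<omega> j = (if j < d then \<omega> ^ (d - j) else 0)"
  by (simp add: target_state_def scale_def superpos_def ket_def if_distrib cong: if_cong)

lemma sqrt_mult_self_complex: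
  "complex_of_real (sqrt (real m)) * complex_of_real (sqrt (real m)) = of_nat m"
  by (simp flip: of_real_mult)

lemma qft_ket_zero:
  assumes "d > 0"
  shows "apply_op (strings d n) (qft d n \<omega>) (ket (replicate n 0)) = uniform_state d n"
proof -
  have "dot (replicate n 0) b = 0" for b by (simp add: dot_def)
  then show ?thesis
    using assms
    by (auto simp: apply_op_ket replicate_in_strings qft_eq uniform_state_eq fun_eq_iff)
qed

text \<open>Inverts the cyclic shift by \<open>i\<close>: since \<open>i + j < 2 * d\<close>, it
  wraps around at most once.\<close>

lemma mod_shift_eq_iff:
  fixes i j b d :: nat
  assumes "i < d" "j < d" "b < d"
  shows "b = (i + j) mod d \<longleftrightarrow> j = (if i \<le> b then b - i else d + b - i)"
proof -
  have "(i + j) mod d = (if i + j < d then i + j else i + j - d)"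
    using assms by (auto simp: mod_if)
  then show ?thesis using assms by auto
qed

section \<open>Powers of a primitive root of unity and orthogonality of characters\<close>

context
  fixes d :: nat and \<omega> :: complex
  assumes d_pos: "d > 0" and primitive: "primitive_root_of_unity d \<omega>"
begin

lemma root_power_d [simp]: "\<omega> ^ d = 1"
  using primitive by (simp add: primitive_root_of_unity_def)

lemma root_cmod [simp]: "cmod \<omega> = 1"
  using power_eq_1_iff[OF root_power_d] d_pos by blast

lemma root_power_mod: "\<omega> ^ (k mod d) = \<omega> ^ k"
proof -
  have "\<omega> ^ k = \<omega> ^ (d * (k div d) + k mod d)" by simp
  also have "\<dots> = \<omega> ^ (k mod d)" by (simp only: power_add power_mult root_power_d) simp
  finally show ?thesis by simp
qed

text \<open>Exponents reduce modulo \<open>d\<close>, and primitivity excludes every nonzero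
  residue.\<close>

lemma root_power_eq_1_iff: "\<omega> ^ k = 1 \<longleftrightarrow> k mod d = 0"
proof -
  have "\<omega> ^ (k mod d) = 1 \<longleftrightarrow> k mod d = 0"
    using primitive d_pos unfolding primitive_root_of_unity_def
    by (metis mod_less_divisor power_0 not_gr_zero)
  then show ?thesis by (simp add: root_power_mod)
qed

lemma root_cnj_mult: "cnj (\<omega> ^ k) * \<omega> ^ k = 1"
  using complex_norm_square[of "\<omega> ^ k"] by (simp add: norm_power mult.commute)

lemma cnj_root_mult_eq_1_iff:
  assumes "a < d" "b < d"
  shows "cnj (\<omega> ^ a) * \<omega> ^ b = 1 \<longleftrightarrow> a = b"
proof
  assume *: "cnj (\<omega> ^ a) * \<omega> ^ b = 1"
  then have eq: "\<omega> ^ b = \<omega> ^ a"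
    using root_cnj_mult[of a] by (metis mult_cancel_left mult_zero_left zero_neq_one)
  \<comment> \<open>Multiplying by \<omega> to the power \<open>d - a\<close> replaces division by
    \<omega> to the power \<open>a\<close> and keeps the exponents natural.\<close>
  have "\<omega> ^ ((d - a) + b) = \<omega> ^ ((d - a) + a)"
    by (simp only: power_add eq)
  also have "\<dots> = 1" using assms by simp
  finally have "((d - a) + b) mod d = 0" by (simp only: root_power_eq_1_iff)
  then show "a = b"
    using assms by (cases "b < a") (auto simp: mod_if split: if_splits)
qed (simp only: root_cnj_mult)

text \<open>The summand is a product of powers of the ratios \<open>?z i\<close>, and
  \<open>?z i = 1\<close> says that the strings agree at digit \<open>i\<close>.\<close>

lemma root_characters_orthogonal:
  assumes "s \<in> strings d n" "t \<in> strings d n"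
  shows "(\<Sum>x\<in>strings d n. cnj (\<omega> ^ dot s x) * \<omega> ^ dot t x) = (if s = t then of_nat (d ^ n) else 0)"
proof -
  let ?z = "\<lambda>i. cnj (\<omega> ^ (s ! i)) * \<omega> ^ (t ! i)"
  have z: "?z i ^ d = 1" for i
    by (simp only: power_mult_distrib flip: power_mult complex_cnj_power)
      (simp add: mult.commute[of _ d] power_mult flip: complex_cnj_power)
  have "(\<Sum>x\<in>strings d n. cnj (\<omega> ^ dot s x) * \<omega> ^ dot t x)
      = (\<Sum>x\<in>strings d n. \<Prod>i<n. ?z i ^ (x ! i))"
    using assms
    by (simp add: power_dot[OF strings_length] power_mult_distrib prod.distrib)
  also have "\<dots> = (if \<forall>i<n. ?z i = 1 then of_nat (d ^ n) else 0)"
    by (rule sum_strings_characters) (rule z)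
  also have "(\<forall>i<n. ?z i = 1) \<longleftrightarrow> s = t"
    using assms cnj_root_mult_eq_1_iff
    by (simp add: list_eq_iff_nth_eq strings_length strings_nth_less del: complex_cnj_power)
  finally show ?thesis .
qed

text \<open>Without the conjugate the exponents add instead of cancelling, so the sum survives only
  for opposite strings. This is why repeating the forward transform yields a negation.\<close>

lemma root_characters_opposite:
  assumes "s \<in> strings d n" "t \<in> strings d n"
  shows "(\<Sum>x\<in>strings d n. \<omega> ^ dot s x * \<omega> ^ dot t x)
    = (if t = neg_mod d s then of_nat (d ^ n) else 0)"
proof -
  let ?z = "\<lambda>i. \<omega> ^ (s ! i + t ! i)"
  have z: "?z i ^ d = 1" for i
    by (metis mult.commute power_mult root_power_d power_one)
  have "(\<Sum>x\<in>strings d n. \<omega> ^ dot s x * \<omega> ^ dot t x)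
      = (\<Sum>x\<in>strings d n. \<Prod>i<n. ?z i ^ (x ! i))"
    using assms
    by (simp add: power_dot[OF strings_length] power_mult_distrib prod.distrib power_add)
  also have "\<dots> = (if \<forall>i<n. ?z i = 1 then of_nat (d ^ n) else 0)"
    by (rule sum_strings_characters) (rule z)
  also have "(\<forall>i<n. ?z i = 1) \<longleftrightarrow> t = neg_mod d s"
    using assms by (simp add: eq_neg_mod_iff root_power_eq_1_iff)
  finally show ?thesis .
qed

section \<open>The Fourier transform: unitarity and its action on phase states\<close>

lemma unitary_on_qft: "unitary_on (strings d n) (qft d n \<omega>)"
  unfolding unitary_on_def
proof (intro ballI)
  fix x y assume xy: "x \<in> strings d n" "y \<in> strings d n"
  have "(\<Sum>z\<in>strings d n. cnj (qft d n \<omega> z x) * qft d n \<omega> z y)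
      = (\<Sum>z\<in>strings d n. cnj (\<omega> ^ dot x z) * \<omega> ^ dot y z) / of_nat (d ^ n)"
    using xy by (simp add: qft_eq sum_divide_distrib sqrt_mult_self_complex[of "d ^ n", simplified])
  then show "(\<Sum>z\<in>strings d n. cnj (qft d n \<omega> z x) * qft d n \<omega> z y) = (if x = y then 1 else 0)"
    using xy d_pos by (simp only: root_characters_orthogonal) simp
qed

text \<open>Lets orthonormality of the columns serve as orthonormality of the rows, which is what
  unitarity of the adjoint requires.\<close>

lemma qft_symmetric: "qft d n \<omega> b a = qft d n \<omega> a b"
  using dot_commute[of a b] by (auto simp: qft_eq strings_length)

lemma unitary_on_adjoint_qft: "unitary_on (strings d n) (adjoint_op (qft d n \<omega>))"
  unfolding unitary_on_def adjoint_op_def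
proof (intro ballI)
  fix x y assume "x \<in> strings d n" "y \<in> strings d n"
  then have "(\<Sum>z\<in>strings d n. cnj (qft d n \<omega> z y) * qft d n \<omega> z x) = (if x = y then 1 else 0)"
    using unitary_on_qft[of n] by (auto simp: unitary_on_def)
  then show "(\<Sum>z\<in>strings d n. cnj (cnj (qft d n \<omega> x z)) * cnj (qft d n \<omega> y z)) = (if x = y then 1 else 0)"
    by (simp add: mult.commute qft_symmetric[of _ x] qft_symmetric[of _ y])
qed

text \<open>The amplitude at \<open>y\<close> is the normalized inner product of the characters of
  \<open>y\<close> and \<open>s\<close>.\<close>

lemma adjoint_qft_phase_state:
  assumes "s \<in> strings d n"
  shows "apply_op (strings d n) (adjoint_op (qft d n \<omega>)) (phase_state d n \<omega> s) = ket s"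
proof
  fix y
  show "apply_op (strings d n) (adjoint_op (qft d n \<omega>)) (phase_state d n \<omega> s) y = ket s y"
  proof (cases "y \<in> strings d n")
    case True
    then have "apply_op (strings d n) (adjoint_op (qft d n \<omega>)) (phase_state d n \<omega> s) y
        = (\<Sum>x\<in>strings d n. cnj (\<omega> ^ dot y x) * \<omega> ^ dot s x) / of_nat (d ^ n)"
      by (simp add: apply_op_def adjoint_op_def qft_eq phase_state_eq sum_divide_distrib
          sqrt_mult_self_complex[of "d ^ n", simplified])
    then show ?thesis
      using True assms d_pos by (simp only: root_characters_orthogonal) (simp add: ket_def)
  qed (use assms in \<open>auto simp: apply_op_def adjoint_op_def qft_eq ket_def\<close>)
qed

lemma qft_phase_state:
  assumes "s \<in> strings d n"
  shows "apply_op (strings d n) (qft d n \<omega>) (phase_state d n \<omega> s) = ket (neg_mod d s)"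
proof
  fix y
  show "apply_op (strings d n) (qft d n \<omega>) (phase_state d n \<omega> s) y = ket (neg_mod d s) y"
  proof (cases "y \<in> strings d n")
    case True
    then have "apply_op (strings d n) (qft d n \<omega>) (phase_state d n \<omega> s) y
        = (\<Sum>x\<in>strings d n. \<omega> ^ dot s x * \<omega> ^ dot y x) / of_nat (d ^ n)"
      by (simp add: apply_op_def qft_eq phase_state_eq sum_divide_distrib dot_commute[of _ y]
          strings_length mult.commute sqrt_mult_self_complex[of "d ^ n", simplified])
    then show ?thesis
      using True assms d_pos by (simp only: root_characters_opposite) (simp add: ket_def)
  qed (use neg_mod_in_strings[OF d_pos assms] in \<open>auto simp: apply_op_def qft_eq ket_def\<close>)
qed

section \<open>Phase kickback\<close>

text \<open>The only \<open>j\<close> that is shifted to \<open>b\<close> is \<open>b - i\<close>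
  modulo \<open>d\<close>. Its amplitude has exponent \<open>d - j\<close>, which is
  \<open>i + (d - b)\<close> modulo \<open>d\<close>.\<close>

lemma target_state_shift:
  assumes "i < d"
  shows "(\<Sum>j<d. if b = (i + j) mod d then target_state d \<omega> j else 0) = \<omega> ^ i * target_state d \<omega> b"
proof (cases "b < d")
  case True
  let ?j = "if i \<le> b then b - i else d + b - i"
  have "(\<Sum>j<d. if b = (i + j) mod d then target_state d \<omega> j else 0)
      = (\<Sum>j<d. if j = ?j then target_state d \<omega> j else 0)"
    by (rule sum.cong) (use assms True mod_shift_eq_iff in auto)
  also have "\<dots> = \<omega> ^ (d - ?j)"
    using assms True by (auto simp: target_state_eq)
  also have "\<dots> = \<omega> ^ (i + (d - b))"
  proof (cases "i \<le> b")
    case False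
    \<comment> \<open>Here the shift wraps around, and the two exponents differ by exactly
      \<open>d\<close>.\<close>
    then have "i + (d - b) = d + (d - ?j)" using assms True by auto
    then show ?thesis by (simp only: power_add root_power_d) simp
  next
    case le: True
    then have "d - ?j = i + (d - b)" using True by simp
    then show ?thesis by (simp only:)
  qed
  also have "\<dots> = \<omega> ^ i * target_state d \<omega> b"
    using True by (simp only: target_state_eq power_add if_True)
  finally show ?thesis .
next
  case False
  \<comment> \<open>Labels outside the qudit are never reached, so both sides are 0.\<close>
  then have "b \<noteq> (i + j) mod d" for j using mod_less_divisor[OF d_pos] by metis
  then show ?thesis using False by (simp add: target_state_eq)
qed

lemma sum_gate_target_state:
  assumes "i < d"
  shows "apply_op ({..<d} \<times> {..<d}) (sum_gate d) (tensor (ket i) (target_state d \<omega>))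
    = scale (\<omega> ^ i) (tensor (ket i) (target_state d \<omega>))"
proof
  fix ab :: "nat \<times> nat"
  obtain a b where [simp]: "ab = (a, b)" by (cases ab)
  have "apply_op ({..<d} \<times> {..<d}) (sum_gate d) (tensor (ket i) (target_state d \<omega>)) ab
      = (\<Sum>k<d. \<Sum>j<d. ket (k, (k + j) mod d) (a, b) * (ket i k * target_state d \<omega> j))"
    by (simp add: apply_op_def sum_gate_def tensor_def sum.cartesian_product split_def)
  also have "\<dots> = (\<Sum>k<d. if k = i then if a = i then
      \<Sum>j<d. if b = (i + j) mod d then target_state d \<omega> j else 0 else 0 else 0)"
    by (intro sum.cong refl) (auto simp: ket_def intro!: sum.cong)
  also have "\<dots> = scale (\<omega> ^ i) (tensor (ket i) (target_state d \<omega>)) ab"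
    using assms by (simp add: target_state_shift scale_def tensor_def ket_def)
  finally show "apply_op ({..<d} \<times> {..<d}) (sum_gate d) (tensor (ket i) (target_state d \<omega>)) ab
      = scale (\<omega> ^ i) (tensor (ket i) (target_state d \<omega>)) ab" .
qed

text \<open>The oracle is block diagonal in \<open>x\<close>, and its block at \<open>x\<close>
  shifts the target by \<open>bv_fun d s x\<close>. The eigenvalue of that shift forgets the
  reduction modulo \<open>d\<close>.\<close>

lemma oracle_gate_phase_kickback:
  "apply_op (strings d n \<times> {..<d}) (oracle_gate d (bv_fun d s))
     (tensor (uniform_state d n) (target_state d \<omega>))
   = tensor (phase_state d n \<omega> s) (target_state d \<omega>)"
proof
  fix yk :: "nat list \<times> nat"
  obtain y k where [simp]: "yk = (y, k)" by (cases yk)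
  let ?f = "bv_fun d s"
  have f: "?f y < d" using d_pos by (simp add: bv_fun_def)
  have "apply_op (strings d n \<times> {..<d}) (oracle_gate d ?f)
      (tensor (uniform_state d n) (target_state d \<omega>)) yk
    = (\<Sum>x\<in>strings d n. \<Sum>j<d. (if y = x then ket (?f x, (?f x + j) mod d) (?f x, k) else 0) *
        (uniform_state d n x * target_state d \<omega> j))"
    by (simp add: apply_op_def oracle_gate_def sum_gate_def tensor_def sum.cartesian_product split_def cong: if_cong)
  also have "\<dots> = (\<Sum>x\<in>strings d n. if x = y then uniform_state d n y *
      (\<Sum>j<d. if k = (?f y + j) mod d then target_state d \<omega> j else 0) else 0)"
    by (intro sum.cong refl) (auto simp: ket_def sum_distrib_left intro!: sum.cong)
  also have "\<dots> = tensor (phase_state d n \<omega> s) (target_state d \<omega>) yk"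
    using target_state_shift[OF f]
    by (simp add: tensor_def phase_state_eq uniform_state_eq bv_fun_def root_power_mod)
  finally show "apply_op (strings d n \<times> {..<d}) (oracle_gate d ?f)
      (tensor (uniform_state d n) (target_state d \<omega>)) yk
    = tensor (phase_state d n \<omega> s) (target_state d \<omega>) yk" .
qed

section \<open>The circuit and its measurement\<close>

lemma apply_on_fst_target_state:
  "apply_op (X \<times> {..<d}) (on_fst A) (tensor \<psi> (target_state d \<omega>))
    = tensor (apply_op X A \<psi>) (target_state d \<omega>)"
  by (rule apply_on_fst_tensor) (simp_all add: target_state_eq)

text \<open>After the query the target is still a separate tensor factor, so \<open>G\<close> meets
  the pure phase state. Leaving \<open>G\<close> arbitrary covers both choices of the last
  transform.\<close>

lemma bv_circuit_eq:
  "bv_circuit d n \<omega> G (bv_fun d s)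
    = tensor (apply_op (strings d n) G (phase_state d n \<omega> s)) (target_state d \<omega>)"
  by (simp add: bv_circuit_def apply_on_fst_target_state qft_ket_zero d_pos
      oracle_gate_phase_kickback)

lemma target_state_norm: "(\<Sum>j<d. (cmod (target_state d \<omega> j))\<^sup>2) = real d"
  by (simp add: target_state_eq norm_power)

text \<open>Numerator and denominator of the Born rule both equal \<open>d\<close>, the squared norm
  of the unnormalized target.\<close>

lemma prob_fst_ket_target_state:
  assumes "t \<in> strings d n"
  shows "prob_fst (strings d n) {..<d} (tensor (ket t) (target_state d \<omega>)) t = 1"
proof -
  have "(\<Sum>b\<in>strings d n \<times> {..<d}. (cmod (tensor (ket t) (target_state d \<omega>) b))\<^sup>2)
      = (\<Sum>x\<in>strings d n. (cmod (ket t x))\<^sup>2) * (\<Sum>j<d. (cmod (target_state d \<omega> j))\<^sup>2)"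
    by (simp add: tensor_def sum_product sum.cartesian_product split_def norm_mult power_mult_distrib)
  also have "(\<Sum>x\<in>strings d n. (cmod (ket t x))\<^sup>2) = 1"
    using assms by (simp add: ket_def if_distrib[of cmod] if_distrib[of "\<lambda>u. u\<^sup>2"] cong: if_cong)
  finally show ?thesis
    using d_pos by (simp add: prob_fst_def target_state_norm) (simp add: tensor_def ket_def target_state_norm)
qed

section \<open>One query suffices\<close>

text \<open>A unitary on the target qudit whose column \<open>0\<close> is the normalized target state: a Fourier
  matrix with rows and columns relabelled.\<close>

definition prepare_op :: "nat oper" where
  "prepare_op = (\<lambda>k j. if k < d then (\<omega> ^ (d - k)) ^ Suc j / complex_of_real (sqrt (real d)) else 0)"

text \<open>The inner product of columns \<open>i\<close> and \<open>j\<close> is a geometric sum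
  whose ratio is a \<open>d\<close>-th root of unity, equal to 1 only for
  \<open>i = j\<close>.\<close>

lemma unitary_on_prepare_op: "unitary_on {..<d} prepare_op"
  unfolding unitary_on_def
proof (intro ballI)
  fix i j assume ij: "i \<in> {..<d}" "j \<in> {..<d}"
  let ?z = "cnj (\<omega> ^ i) * \<omega> ^ j"
  have z: "?z ^ d = 1"
    by (simp only: power_mult_distrib flip: power_mult complex_cnj_power)
      (simp add: mult.commute[of _ d] power_mult flip: complex_cnj_power)
  have term_eq: "cnj (prepare_op k i) * prepare_op k j = ?z ^ (d - k) / of_nat d" if "k < d" for k
  proof -
    let ?w = "\<omega> ^ (d - k)"
    \<comment> \<open>The offset \<open>Suc\<close> contributes one extra factor
      \<open>cnj ?w * ?w\<close>, which is 1.\<close>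
    have "cnj (?w ^ Suc i) * ?w ^ Suc j = (cnj ?w * ?w) * (cnj (?w ^ i) * ?w ^ j)"
      by (simp add: algebra_simps)
    also have "\<dots> = cnj (?w ^ i) * ?w ^ j"
      by (simp only: root_cnj_mult mult_1_left)
    also have "\<dots> = ?z ^ (d - k)"
      by (simp add: power_mult_distrib mult.commute flip: power_mult)
    finally show ?thesis
      using that by (simp add: prepare_op_def sqrt_mult_self_complex)
  qed
  have "(\<Sum>k<d. cnj (prepare_op k i) * prepare_op k j) = (\<Sum>k<d. ?z ^ (d - k)) / of_nat d"
    by (simp add: term_eq sum_divide_distrib)
  \<comment> \<open>The exponents run over 1 to \<open>d\<close> instead of 0 to
    \<open>d - 1\<close>, hence the extra factor \<open>?z\<close>; it is 1 in the case
    \<open>i = j\<close>.\<close>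
  also have "(\<Sum>k<d. ?z ^ (d - k)) = ?z * (\<Sum>k<d. ?z ^ k)"
  proof -
    have "(\<Sum>k<d. ?z ^ (d - k)) = (\<Sum>k<d. ?z ^ Suc k)"
      by (rule sum.reindex_bij_witness[of _ "\<lambda>k. d - Suc k" "\<lambda>k. d - Suc k"]) (auto simp: Suc_diff_Suc)
    then show ?thesis by (simp add: sum_distrib_left)
  qed
  also have "(\<Sum>k<d. ?z ^ k) = (if i = j then of_nat d else 0)"
    using ij cnj_root_mult_eq_1_iff[of i j] by (simp only: geometric_sum_root_of_unity[OF z]) auto
  finally have "(\<Sum>k<d. cnj (prepare_op k i) * prepare_op k j)
      = ?z * (if i = j then of_nat d else 0) / of_nat d" .
  then show "(\<Sum>k<d. cnj (prepare_op k i) * prepare_op k j) = (if i = j then 1 else 0)"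
    using d_pos root_cnj_mult[of i] by (auto simp del: complex_cnj_power)
qed

lemma prepare_op_ket_zero:
  "apply_op {..<d} prepare_op (ket 0) = scale (1 / complex_of_real (sqrt (real d))) (target_state d \<omega>)"
  using d_pos by (auto simp: apply_op_ket prepare_op_def scale_def target_state_eq fun_eq_iff)

text \<open>\<open>bv_solvable\<close> starts from a basis ket and allows only unitaries, so the
  target state must be prepared, and normalized, by the circuit itself.\<close>

lemma bv_solvable_one:
  assumes "p \<le> 1"
  shows "bv_solvable p d n 1"
proof -
  let ?S = "strings d n"
  let ?G = "adjoint_op (qft d n \<omega>)"
  let ?c = "1 / complex_of_real (sqrt (real d))"
  let ?B = "(?S \<times> {..<d}) \<times> {..<1::nat}"
  define U :: "nat \<Rightarrow> ((nat list \<times> nat) \<times> nat) oper" where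
    "U = (\<lambda>k. on_fst (if k = 0 then tensor_op (qft d n \<omega>) prepare_op else on_fst ?G))"
  define res :: "(nat list \<times> nat) \<times> nat \<Rightarrow> nat list" where "res = (\<lambda>b. fst (fst b))"
  have unitary: "unitary_on ?B (U k)" for k
    by (simp add: U_def unitary_on_on_fst unitary_on_tensor_op unitary_on_qft
        unitary_on_prepare_op unitary_on_adjoint_qft)
  have success: "p \<le> (\<Sum>b\<in>{b \<in> ?B. res b = s}.
      (cmod (query_state ?B (on_fst (oracle_gate d (bv_fun d s))) U 1
        (ket ((replicate n 0, 0), 0)) b))\<^sup>2)" if s: "s \<in> ?S" for s
  proof -
    have ket0: "apply_op (X \<times> {..<Suc 0}) (on_fst A) (tensor \<psi> (ket 0))
        = tensor (apply_op X A \<psi>) (ket 0)" for X :: "(nat list \<times> nat) set" and A \<psi>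
      by (rule apply_on_fst_tensor) (simp_all add: ket_def)
    have "query_state ?B (on_fst (oracle_gate d (bv_fun d s))) U 1 (ket ((replicate n 0, 0), 0))
        = tensor (scale ?c (tensor (ket s) (target_state d \<omega>))) (ket 0)"
      by (simp add: U_def ket0 apply_tensor_op qft_ket_zero d_pos
          prepare_op_ket_zero tensor_scale_right apply_op_scale oracle_gate_phase_kickback
          apply_on_fst_target_state adjoint_qft_phase_state[OF s] flip: tensor_ket)
    \<comment> \<open>The target label is free in the success event, so the squared amplitudes of
      the whole normalized target are summed.\<close>
    moreover have "{b \<in> ?B. res b = s} = (\<lambda>j. ((s, j), 0)) ` {..<d}"
      using s by (auto simp: res_def)
    ultimately have "(\<Sum>b\<in>{b \<in> ?B. res b = s}.
      (cmod (query_state ?B (on_fst (oracle_gate d (bv_fun d s))) U 1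
        (ket ((replicate n 0, 0), 0)) b))\<^sup>2) = (\<Sum>j<d. (cmod (?c * target_state d \<omega> j))\<^sup>2)"
      by (simp add: sum.reindex inj_on_def) (simp add: tensor_def scale_def ket_def)
    also have "\<dots> = (cmod ?c)\<^sup>2 * (\<Sum>j<d. (cmod (target_state d \<omega> j))\<^sup>2)"
      by (simp only: norm_mult power_mult_distrib sum_distrib_left)
    also have "\<dots> = 1"
      using d_pos unfolding target_state_norm by (simp add: norm_divide power_divide)
    finally show ?thesis using assms by simp
  qed
  show ?thesis
    unfolding bv_solvable_def Let_def
  proof (intro exI conjI)
    show "0 < (1::nat)" by simp
    show "\<forall>k\<le>1. unitary_on ?B (U k)" using unitary by blast
    show "\<forall>s\<in>?S. p \<le> (\<Sum>b\<in>{b \<in> ?B. res b = s}.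
      (cmod (query_state ?B (on_fst (oracle_gate d (bv_fun d s))) U 1
        (ket ((replicate n 0, 0), 0)) b))\<^sup>2)" using success by blast
  qed
qed

end

section \<open>The lower bound and the exact query complexity\<close>

lemma not_bv_solvable_zero:
  assumes "d \<ge> 2" "n \<ge> 1" "p > 1 / 2"
  shows "\<not> bv_solvable p d n 0"
proof
  assume "bv_solvable p d n 0"
  \<comment> \<open>With zero queries only \<open>U 0\<close> is applied; it becomes
    \<open>V\<close>, and the oracle disappears.\<close>
  then have "\<exists>m>0. \<exists>(V :: ((nat list \<times> nat) \<times> nat) oper) (res :: (nat list \<times> nat) \<times> nat \<Rightarrow> nat list).
      unitary_on ((strings d n \<times> {..<d}) \<times> {..<m}) V \<and> (\<forall>s\<in>strings d n.
        p \<le> (\<Sum>b\<in>{b \<in> (strings d n \<times> {..<d}) \<times> {..<m}. res b = s}.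
          (cmod (apply_op ((strings d n \<times> {..<d}) \<times> {..<m}) V (ket ((replicate n 0, 0), 0)) b))\<^sup>2))"
    unfolding bv_solvable_def Let_def query_state.simps le_zero_eq
    by (elim ex_forward conj_forward) auto
  then obtain m V and res :: "(nat list \<times> nat) \<times> nat \<Rightarrow> nat list" where m: "m > 0"
    and V: "unitary_on ((strings d n \<times> {..<d}) \<times> {..<m}) V"
    and succ: "\<forall>s\<in>strings d n.
       p \<le> (\<Sum>b\<in>{b \<in> (strings d n \<times> {..<d}) \<times> {..<m}. res b = s}.
         (cmod (apply_op ((strings d n \<times> {..<d}) \<times> {..<m}) V (ket ((replicate n 0, 0), 0)) b))\<^sup>2)"
    by (elim exE conjE) (rule that)
  define B where "B = (strings d n \<times> {..<d}) \<times> {..<m}"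
  define b0 :: "(nat list \<times> nat) \<times> nat" where "b0 = ((replicate n 0, 0), 0)"
  define P where "P = (\<lambda>b. (cmod (V b b0))\<^sup>2)"
  have fin: "finite B" by (simp add: B_def)
  have b0: "b0 \<in> B" using assms m by (simp add: B_def b0_def replicate_in_strings)
  \<comment> \<open>The outcome distribution \<open>P\<close> is read off from column
    \<open>b0\<close> of \<open>V\<close>, the same for every \<open>s\<close>.\<close>
  have succ': "p \<le> sum P {b \<in> B. res b = s}" if "s \<in> strings d n" for s
    using bspec[OF succ that, folded B_def b0_def] unfolding apply_op_ket[OF fin b0] P_def .
  \<comment> \<open>Two candidates suffice: the digit 1 is available because
    \<open>d \<ge> 2\<close>, and the strings differ because \<open>n \<ge> 1\<close>.\<close>
  define s t where "s = replicate n (0::nat)" and "t = replicate n (1::nat)"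
  have st: "s \<in> strings d n" "t \<in> strings d n"
    using assms by (simp_all add: s_def t_def replicate_in_strings)
  have "s \<noteq> t" using assms by (auto simp: s_def t_def)
  have "2 * p \<le> sum P {b \<in> B. res b = s} + sum P {b \<in> B. res b = t}"
    using succ'[OF st(1)] succ'[OF st(2)] by simp
  also have "\<dots> = sum P ({b \<in> B. res b = s} \<union> {b \<in> B. res b = t})"
    using fin \<open>s \<noteq> t\<close> by (intro sum.union_disjoint[symmetric]) auto
  also have "\<dots> \<le> sum P B"
    using fin by (intro sum_mono2) (auto simp: P_def)
  also have "\<dots> = 1"
    unfolding P_def by (rule unitary_on_column_norm[OF V[folded B_def] b0])
  finally show False using assms by simp
qed

text \<open>The bound \<open>p \<le> 1\<close> serves the one-query algorithm, which succeeds with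
  certainty; \<open>1 / 2 < p\<close> serves the exclusion of zero queries.\<close>

lemma bv_query_complexity_eq_1:
  assumes "d \<ge> 2" "n \<ge> 1" "primitive_root_of_unity d \<omega>" "1 / 2 < p" "p \<le> 1"
  shows "bv_query_complexity p d n = 1"
  unfolding bv_query_complexity_def
proof (rule Least_equality)
  show "bv_solvable p d n 1"
    using assms by (intro bv_solvable_one[where \<omega> = \<omega>]) auto
  show "1 \<le> q" if "bv_solvable p d n q" for q
    using that not_bv_solvable_zero[OF assms(1,2,4)] by (cases q) auto
qed

text \<open>Provides the case \<open>d = 2\<close> for the comparison of query complexities.\<close>

lemma primitive_root_of_unity_2: "primitive_root_of_unity 2 (-1)"
  unfolding primitive_root_of_unity_def
proof (intro conjI allI impI)
  fix k :: nat assume "0 < k \<and> k < 2"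
  then have "k = 1" by linarith
  then show "(- 1 :: complex) ^ k \<noteq> 1" by simp
qed simp

text \<open>The last transform occurs in two versions: the inverse returns \<open>s\<close> itself,
  while the forward one returns the negation of \<open>s\<close>, from which applying
  \<open>neg_mod\<close> classically recovers \<open>s\<close>.\<close>

theorem mainTheorem1:
  fixes d n :: nat and \<omega> :: complex
  assumes "d \<ge> 2" and "n \<ge> 1" and "primitive_root_of_unity d \<omega>"
  shows
    "apply_op (strings d n) (qft d n \<omega>) (ket (replicate n 0)) = uniform_state d n
     \<and> (\<forall>i<d. apply_op ({..<d} \<times> {..<d}) (sum_gate d) (tensor (ket i) (target_state d \<omega>))
               = scale (\<omega> ^ i) (tensor (ket i) (target_state d \<omega>)))
     \<and> (\<forall>s\<in>strings d n.
          (\<forall>x\<in>strings d n. \<omega> ^ bv_fun d s x = \<omega> ^ dot s x)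
          \<and> apply_op (strings d n \<times> {..<d}) (oracle_gate d (bv_fun d s))
               (tensor (uniform_state d n) (target_state d \<omega>))
             = tensor (phase_state d n \<omega> s) (target_state d \<omega>)
          \<and> apply_op (strings d n) (adjoint_op (qft d n \<omega>)) (phase_state d n \<omega> s) = ket s
          \<and> prob_fst (strings d n) {..<d}
               (bv_circuit d n \<omega> (adjoint_op (qft d n \<omega>)) (bv_fun d s)) s = 1
          \<and> apply_op (strings d n) (qft d n \<omega>) (phase_state d n \<omega> s) = ket (neg_mod d s)
          \<and> prob_fst (strings d n) {..<d}
               (bv_circuit d n \<omega> (qft d n \<omega>) (bv_fun d s)) (neg_mod d s) = 1
          \<and> neg_mod d (neg_mod d s) = s
          \<and> (apply_op (strings d n) (qft d n \<omega>) (phase_state d n \<omega> s) = ket s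
               \<longleftrightarrow> (\<forall>i<n. 2 * s ! i mod d = 0)))
     \<and> (\<forall>p. 1 / 2 < p \<and> p \<le> 1 \<longrightarrow>
          bv_query_complexity p d n = 1
          \<and> bv_query_complexity p d n = bv_query_complexity p 2 n
          \<and> (\<lambda>k. real (bv_query_complexity p d k)) \<in> \<Omega>(\<lambda>_. 1))"
proof (intro conjI ballI allI impI)
  have d: "d > 0" using assms by simp
  note prim = assms(3)
  show "apply_op (strings d n) (qft d n \<omega>) (ket (replicate n 0)) = uniform_state d n"
    using d by (rule qft_ket_zero)
  show "apply_op ({..<d} \<times> {..<d}) (sum_gate d) (tensor (ket i) (target_state d \<omega>))
      = scale (\<omega> ^ i) (tensor (ket i) (target_state d \<omega>))" if "i < d" for i
    using sum_gate_target_state[OF d prim that] .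
  fix s assume s: "s \<in> strings d n"
  show "\<omega> ^ bv_fun d s x = \<omega> ^ dot s x" for x
    by (simp add: bv_fun_def root_power_mod[OF d prim])
  show "apply_op (strings d n \<times> {..<d}) (oracle_gate d (bv_fun d s))
      (tensor (uniform_state d n) (target_state d \<omega>))
    = tensor (phase_state d n \<omega> s) (target_state d \<omega>)"
    by (rule oracle_gate_phase_kickback[OF d prim])
  show adj: "apply_op (strings d n) (adjoint_op (qft d n \<omega>)) (phase_state d n \<omega> s) = ket s"
    by (rule adjoint_qft_phase_state[OF d prim s])
  show "prob_fst (strings d n) {..<d} (bv_circuit d n \<omega> (adjoint_op (qft d n \<omega>)) (bv_fun d s)) s = 1"
    by (simp add: bv_circuit_eq[OF d prim] adj prob_fst_ket_target_state[OF d prim s])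
  show qft: "apply_op (strings d n) (qft d n \<omega>) (phase_state d n \<omega> s) = ket (neg_mod d s)"
    by (rule qft_phase_state[OF d prim s])
  show "prob_fst (strings d n) {..<d} (bv_circuit d n \<omega> (qft d n \<omega>) (bv_fun d s)) (neg_mod d s) = 1"
    by (simp add: bv_circuit_eq[OF d prim] qft
        prob_fst_ket_target_state[OF d prim neg_mod_in_strings[OF d s]])
  show "neg_mod d (neg_mod d s) = s"
    by (rule neg_mod_neg_mod[OF d s])
  show "apply_op (strings d n) (qft d n \<omega>) (phase_state d n \<omega> s) = ket s
      \<longleftrightarrow> (\<forall>i<n. 2 * s ! i mod d = 0)"
    \<comment> \<open>Distinct labels have distinct kets, so the claim is that \<open>s\<close> is
      its own negation.\<close>
    using eq_neg_mod_iff[OF s s] by (auto simp: qft ket_eq_iff mult_2)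
next
  fix p :: real assume "1 / 2 < p \<and> p \<le> 1"
  then have p: "1 / 2 < p" "p \<le> 1" by simp_all
  have eq: "bv_query_complexity p d k = 1" if "k \<ge> 1" for k
    using bv_query_complexity_eq_1[OF assms(1) that assms(3) p] .
  show "bv_query_complexity p d n = 1"
    using assms(2) by (rule eq)
  then show "bv_query_complexity p d n = bv_query_complexity p 2 n"
    using bv_query_complexity_eq_1[OF _ assms(2) primitive_root_of_unity_2 p] by simp
  show "(\<lambda>k. real (bv_query_complexity p d k)) \<in> \<Omega>(\<lambda>_. 1)"
    \<comment> \<open>The threshold 1 leaves out strings of length 0, to which \<open>eq\<close>
      does not apply.\<close>
    by (rule landau_omega.bigI[of 1])
      (auto intro!: eventually_sequentiallyI[of 1] simp: eq[unfolded One_nat_def])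
qed

end
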